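(* Let $K\subset L$ be an extension of fields (possibly skew), with $K$ commutative and central in $L$. Let $B$ be a finite-dimensional $K$-subspace of $L$. Then $B$ is matched to itself if and only if $1\notin B$.
   Context: "Field" means a division ring (skew field). $K$ is central in $L$ if $\lambda x=x\lambda$ for all $\lambda\in K$, $x\in L$. Let $A,B$ be $n$-dimensional $K$-subspaces of $L$, with (indexed) bases $\mathcal{A}=\{a_1,\ldots,a_n\}$ of $A$ and $\mathcal{B}=\{b_1,\ldots,b_n\}$ of $B$. We say that $\mathcal{A}$ is matched to $\mathcal{B}$ if for all $i=1,\ldots,n$ and all $b\in B$: $a_ib\in A$ implies $b\in\langle b_1,\ldots,\widehat{b_i},\ldots,b_n\rangle$; equivalently, $a_i^{-1}A\cap B\subset\langle b_1,\ldots,\widehat{b_i},\ldots,b_n\rangle$ for all $i$. Here $\langle b_1,\ldots,\widehat{b_i},\ldots,b_n\rangle$ is the $K$-subspace spanned by the $b_j$ with $j\neq i$. We say that $A$ is matched to $B$ if every basis $\mathcal{A}$ of $A$ can be matched to some basis $\mathcal{B}$ of $B$ (i.e. for every basis $\mathcal{A}$ of $A$ there exists a basis $\mathcal{B}$ of $B$ such that $\mathcal{A}$ is matched to $\mathcal{B}$). "$B$ is matched to itself" is the case $A=B$. *)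

theory Defs
  imports Complex_Main
begin

text \<open>
  An extension of a division ring \<open>L\<close> over a commutative central subfield \<open>K\<close>.  As usual in
  type-class algebra, \<open>K\<close> and \<open>L\<close> are types and the inclusion is a unital ring homomorphism
  \<open>emb\<close> (automatically injective), so that \<open>K\<close> is identified with its image in \<open>L\<close>.
  The \<open>K\<close>-vector space structure of \<open>L\<close> is multiplication by elements of \<open>K\<close>.
\<close>

locale central_extension =
  fixes emb :: "'k::field \<Rightarrow> 'l::division_ring"
  assumes emb_one: "emb 1 = 1"
    and emb_add: "emb (c + d) = emb c + emb d"
    and emb_mult: "emb (c * d) = emb c * emb d"
    and emb_central: "emb c * x = x * emb c"

sublocale central_extension \<subseteq> vs: vector_space "\<lambda>c x. emb c * x"
  by unfold_locales (simp_all add: emb_one emb_add emb_mult algebra_simps)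

context central_extension
begin

definition fin_dim_subspace :: "'l set \<Rightarrow> bool" where
  "fin_dim_subspace V \<longleftrightarrow> vs.subspace V \<and> (\<exists>S. finite S \<and> vs.span S = V)"

text \<open>
  Bases are indexed families \<open>a 1, \<dots>, a n\<close>; the values of \<open>a\<close> outside \<open>{1..n}\<close> are irrelevant.
\<close>

definition indexed_basis :: "nat \<Rightarrow> (nat \<Rightarrow> 'l) \<Rightarrow> 'l set \<Rightarrow> bool" where
  "indexed_basis n a V \<longleftrightarrow>
     inj_on a {1..n} \<and> vs.independent (a ` {1..n}) \<and> vs.span (a ` {1..n}) = V"

definition basis_matched ::
    "nat \<Rightarrow> 'l set \<Rightarrow> (nat \<Rightarrow> 'l) \<Rightarrow> 'l set \<Rightarrow> (nat \<Rightarrow> 'l) \<Rightarrow> bool" where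
  "basis_matched n A a B b \<longleftrightarrow>
     (\<forall>i\<in>{1..n}. \<forall>x\<in>B. a i * x \<in> A \<longrightarrow> x \<in> vs.span (b ` ({1..n} - {i})))"

text \<open>
  Meant for finite-dimensional subspaces \<open>A\<close> and \<open>B\<close> of the same dimension.
\<close>

definition subspace_matched :: "'l set \<Rightarrow> 'l set \<Rightarrow> bool" where
  "subspace_matched A B \<longleftrightarrow>
     (\<forall>a. indexed_basis (vs.dim A) a A \<longrightarrow>
        (\<exists>b. indexed_basis (vs.dim A) b B \<and> basis_matched (vs.dim A) A a B b))"

end

end

theory Submission imports Defs begin

text \<open>
  Write \<open>V\<^sub>i = {x \<in> B. a\<^sub>i x \<in> B}\<close>. A basis matched to \<open>a\<close> amounts to hyperplanes
  \<open>H\<^sub>i \<supseteq> V\<^sub>i\<close> of \<open>B\<close> with zero intersection, and by the dual of Rado's theorem they exist as soon as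
  the intersection of the \<open>V\<^sub>i\<close> over any index set \<open>J\<close> has codimension at least \<open>|J|\<close>. With \<open>A\<close>
  the span of the \<open>a\<^sub>i\<close> for \<open>i \<in> J\<close> and \<open>W\<close> that intersection, \<open>A W \<subseteq> B\<close>, and a linear version of
  Kemperman's transform gives \<open>dim A + dim W \<le> dim B\<close> whenever \<open>1 \<notin> B\<close>. Conversely, if \<open>1 \<in> B\<close>, a basis
  of \<open>B\<close> containing \<open>1\<close> cannot be matched.
\<close>

section \<open>Dimension inequalities for finitely spanned subspaces\<close>

context vector_space
begin

text \<open>The ambient space may be infinite-dimensional, so finiteness is carried by a finite
  \<open>X\<close> whose span contains \<open>V\<close>; the later dimension lemmas take the same
  form.\<close>

lemma finite_basis_exists:
  assumes "finite X" "V \<subseteq> span X"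
  obtains C where "finite C" "C \<subseteq> V" "independent C" "V \<subseteq> span C" "card C = dim V"
proof -
  obtain C where C: "C \<subseteq> V" "independent C" "V \<subseteq> span C" "card C = dim V"
    by (rule basis_exists)
  have "finite C"
    using independent_span_bound[OF assms(1) C(2)] C(1) assms(2) by blast
  with C that show thesis by blast
qed

lemma dim_mono_finite:
  assumes "finite X" "T \<subseteq> span X" "S \<subseteq> T"
  shows "dim S \<le> dim T"
  by (metis assms dim_le_card finite_basis_exists subset_trans)

lemma subspace_eq_of_dim_le:
  assumes X: "finite X" "T \<subseteq> span X" and S: "subspace S" "S \<subseteq> T" and le: "dim T \<le> dim S"
  shows "S = T"
proof (rule ccontr)
  assume "S \<noteq> T"
  then obtain x where x: "x \<in> T" "x \<notin> S" using S by blast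
  have "S \<subseteq> span X" using S X by blast
  from finite_basis_exists[OF X(1) this] obtain C where
    C: "finite C" "C \<subseteq> S" "independent C" "S \<subseteq> span C" "card C = dim S" by blast
  have xC: "x \<notin> span C" using C(2) S(1) x(2) span_minimal by blast
  then have "independent (insert x C)" using C(3) by (simp add: independent_insertI)
  then have "dim (insert x C) = card (insert x C)" by (rule dim_eq_card_independent)
  also have "\<dots> = Suc (dim S)"
    using xC C by (metis card_insert_disjoint span_base)
  finally have "dim (insert x C) = Suc (dim S)" .
  moreover have "dim (insert x C) \<le> dim T"
    by (rule dim_mono_finite[OF X]) (use x C S in blast)
  ultimately show False using le by simp
qed

text \<open>One half of Grassmann's formula. A basis \<open>C\<close> of the intersection grows to a
  basis \<open>D\<close> of \<open>S\<close> and then to a basis \<open>E\<close> of the sum;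
  \<open>C\<close> and the vectors added last span \<open>T\<close>.\<close>

lemma dim_add_le:
  assumes X: "finite X" "S \<subseteq> span X" "T \<subseteq> span X" and ss: "subspace S" "subspace T"
  shows "dim S + dim T \<le> dim (span (S \<union> T)) + dim (S \<inter> T)"
proof -
  have "S \<inter> T \<subseteq> span X" using X by blast
  from finite_basis_exists[OF X(1) this] obtain C where
    C: "finite C" "C \<subseteq> S \<inter> T" "independent C" "S \<inter> T \<subseteq> span C" "card C = dim (S \<inter> T)"
    by blast
  from C(2) have "C \<subseteq> S" by blast
  from maximal_independent_subset_extend[OF this C(3)] obtain D where
    D: "C \<subseteq> D" "D \<subseteq> S" "independent D" "S \<subseteq> span D" by blast
  from D(2) have "D \<subseteq> S \<union> T" by blast
  from maximal_independent_subset_extend[OF this D(3)] obtain E where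
    E: "D \<subseteq> E" "E \<subseteq> S \<union> T" "independent E" "S \<union> T \<subseteq> span E" by blast
  have finE: "finite E"
    using independent_span_bound[OF X(1) E(3)] E(2) X by blast
  then have finD: "finite D" using E(1) finite_subset by blast
  have dE: "dim (span (S \<union> T)) = card E"
    using E by (metis basis_card_eq_dim dim_span)
  have dS: "dim S = card D"
    using D by (metis basis_card_eq_dim)
  \<comment> \<open>A vector of \<open>E - D\<close> lying in \<open>S\<close> would be in
    \<open>span D\<close>, against the independence of \<open>E\<close>.\<close>
  have ED: "E - D \<subseteq> T"
  proof
    fix x assume x: "x \<in> E - D"
    have "D \<subseteq> E - {x}" using x E(1) by blast
    then have "span D \<subseteq> span (E - {x})" by (rule span_mono)
    then have "x \<notin> span D" using x E(3) unfolding dependent_def by blast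
    then show "x \<in> T" using x E(2) D(4) by blast
  qed
  \<comment> \<open>In \<open>t = u + v\<close> the part \<open>v\<close> lies in \<open>T\<close>
    by \<open>ED\<close>, so \<open>u\<close> lies in both \<open>S\<close> and \<open>T\<close>,
    where \<open>C\<close> spans.\<close>
  have "T \<subseteq> span (C \<union> (E - D))"
  proof
    fix t assume t: "t \<in> T"
    have "D \<union> (E - D) = E" using E(1) by blast
    then have "t \<in> span (D \<union> (E - D))" using t E(4) by auto
    then obtain u v where uv: "u \<in> span D" "v \<in> span (E - D)" "t = u + v"
      unfolding span_Un by blast
    have "v \<in> T" using uv(2) ED ss(2) span_minimal by blast
    with t uv(3) ss(2) have "u \<in> T" by (metis add_diff_cancel_right' subspace_diff)
    moreover have "u \<in> S" using uv(1) D(2) ss(1) span_minimal by blast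
    ultimately have "u \<in> span C" using C(4) by blast
    with uv show "t \<in> span (C \<union> (E - D))" unfolding span_Un by blast
  qed
  then have "dim T \<le> card (C \<union> (E - D))"
    using C(1) finE by (intro dim_le_card) auto
  also have "\<dots> \<le> card C + card (E - D)" by (rule card_Un_le)
  also have "card (E - D) = card E - card D" using finD E(1) by (rule card_Diff_subset)
  finally show ?thesis
    using dE dS C(5) card_mono[OF finE E(1)] by linarith
qed

lemma dim_image_le_finite:
  assumes "module_hom scale scale f" "finite X" "S \<subseteq> span X"
  shows "dim (f ` S) \<le> dim S"
proof -
  interpret f: module_hom scale scale f by fact
  from finite_basis_exists[OF assms(2,3)] obtain C where
    C: "finite C" "C \<subseteq> S" "independent C" "S \<subseteq> span C" "card C = dim S" by blast
  have "f ` S \<subseteq> span (f ` C)" using C(4) f.span_image by blast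
  then have "dim (f ` S) \<le> card (f ` C)" using C(1) by (intro dim_le_card) auto
  also have "\<dots> \<le> card C" using C(1) by (rule card_image_le)
  finally show ?thesis using C(5) by simp
qed

lemma dim_image_inverse:
  assumes f: "module_hom scale scale f" and g: "module_hom scale scale g"
    and gf: "\<And>x. g (f x) = x" and X: "finite X" "S \<subseteq> span X"
  shows "dim (f ` S) = dim S"
proof (rule antisym)
  show "dim (f ` S) \<le> dim S" by (rule dim_image_le_finite[OF f X])
  interpret f: module_hom scale scale f by fact
  have "f ` S \<subseteq> span (f ` X)" using X(2) f.span_image by blast
  from dim_image_le_finite[OF g _ this] have "dim (g ` f ` S) \<le> dim (f ` S)"
    using X by simp
  then show "dim S \<le> dim (f ` S)" by (simp add: image_image gf)
qed

lemma dim_transform: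
  assumes f: "module_hom scale scale f" and g: "module_hom scale scale g"
    and gf: "\<And>x. g (f x) = x" and X: "finite X" "S \<subseteq> span X" and S: "subspace S"
  shows "2 * dim S \<le> dim (span (S \<union> f ` S)) + dim {x \<in> S. f x \<in> S}"
proof -
  interpret f: module_hom scale scale f by fact
  have "S \<subseteq> span (X \<union> f ` X)" "f ` S \<subseteq> span (X \<union> f ` X)"
    using X(2) f.span_image span_mono[of X "X \<union> f ` X"] span_mono[of "f ` X" "X \<union> f ` X"] by blast+
  then have "dim S + dim (f ` S) \<le> dim (span (S \<union> f ` S)) + dim (S \<inter> f ` S)"
    using X S f.subspace_image by (intro dim_add_le[of "X \<union> f ` X"]) auto
  moreover have "S \<inter> f ` S = f ` {x \<in> S. f x \<in> S}" by blast
  moreover have "dim (f ` {x \<in> S. f x \<in> S}) = dim {x \<in> S. f x \<in> S}"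
    using X by (intro dim_image_inverse[OF f g gf, of X]) auto
  ultimately show ?thesis using dim_image_inverse[OF f g gf X] by simp
qed

lemma subspace_INT:
  assumes "subspace U" "\<And>i. i \<in> J \<Longrightarrow> subspace (V i)"
  shows "subspace (U \<inter> (\<Inter>i\<in>J. V i))"
  using assms by (auto simp: subspace_def)

lemma dim_span_insert_le:
  assumes "finite X" "V \<subseteq> span X"
  shows "dim (span (insert x V)) \<le> Suc (dim V)"
proof -
  from finite_basis_exists[OF assms] obtain C where
    C: "finite C" "C \<subseteq> V" "independent C" "V \<subseteq> span C" "card C = dim V" by blast
  have "span (insert x V) \<subseteq> span (insert x C)"
    using C(4) span_mono[of C "insert x C"] span_base[of x "insert x C"]
    by (intro span_minimal) auto
  then have "dim (span (insert x V)) \<le> card (insert x C)"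
    using C(1) by (intro dim_le_card) auto
  also have "\<dots> \<le> Suc (card C)" by (rule card_insert_le_m1) (auto simp: C(1))
  finally show ?thesis using C(5) by simp
qed

section \<open>Rado's condition and bases dual to hyperplanes\<close>

text \<open>For finite-dimensional \<open>U\<close> and finite \<open>I\<close> this is Rado's
  condition on the annihilators of the \<open>V i\<close> in the dual of \<open>U\<close>: those
  with index in \<open>J\<close> span dimension at least \<open>card J\<close>. The factor
  \<open>U\<close> gives the empty intersection its right value.\<close>

definition rado_family :: "'b set \<Rightarrow> 'i set \<Rightarrow> ('i \<Rightarrow> 'b set) \<Rightarrow> bool" where
  "rado_family U I V \<longleftrightarrow> (\<forall>i\<in>I. subspace (V i) \<and> V i \<subseteq> U) \<and>
     (\<forall>J\<subseteq>I. dim (U \<inter> (\<Inter>i\<in>J. V i)) + card J \<le> dim U)"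

text \<open>
  A member of codimension at
  least 2 has two enlargements meeting in it; if both broke the dimension condition, submodularity
  would contradict the condition for the original family.
\<close>

lemma rado_family_enlarge:
  assumes I: "finite I" and X: "finite X" "U \<subseteq> span X" and U: "subspace U"
    and V: "local.rado_family U I V" and i: "i \<in> I" "Suc (dim (V i)) \<noteq> dim U"
  obtains R where "V i \<subset> R" "local.rado_family U I (V(i := R))"
proof -
  define F where "F J = U \<inter> (\<Inter>j\<in>J. V j)" for J
  have sub: "subspace (V j)" "V j \<subseteq> U" if "j \<in> I" for j
    using V that by (auto simp: rado_family_def)
  have rado: "dim (F J) + card J \<le> dim U" if "J \<subseteq> I" for J
    using V that by (auto simp: rado_family_def F_def)
  have subF: "subspace (F J)" if "J \<subseteq> I" for J
    unfolding F_def using U sub that by (intro subspace_INT) auto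
  have VX: "V i \<subseteq> span X" using sub(2)[OF i(1)] X(2) by blast
  have spV: "span (V i) = V i" using sub(1)[OF i(1)] by (simp add: span_eq_iff)
  have "F {i} = V i" using sub(2)[OF i(1)] by (auto simp: F_def)
  \<comment> \<open>The condition for \<open>{i}\<close> gives codimension at least 1, and
    codimension 1 is excluded by assumption.\<close>
  then have codim: "Suc (Suc (dim (V i))) \<le> dim U" using rado[of "{i}"] i by simp
  have "V i \<noteq> U" using codim by auto
  then obtain x where x: "x \<in> U" "x \<notin> V i" using sub(2)[OF i(1)] by blast
  define P where "P = span (insert x (V i))"
  have PU: "P \<subseteq> U" unfolding P_def using x sub(2)[OF i(1)] U by (intro span_minimal) auto
  have "dim P \<le> Suc (dim (V i))" unfolding P_def by (rule dim_span_insert_le[OF X(1) VX])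
  then have "P \<noteq> U" using codim by auto
  then obtain y where y: "y \<in> U" "y \<notin> P" using PU by blast
  define Q where "Q = span (insert y (V i))"
  have QU: "Q \<subseteq> U" unfolding Q_def using y sub(2)[OF i(1)] U by (intro span_minimal) auto
  have VP: "V i \<subseteq> P" and VQ: "V i \<subseteq> Q" unfolding P_def Q_def by (auto intro: span_base)
  have xP: "x \<in> P" and yQ: "y \<in> Q" unfolding P_def Q_def by (auto intro: span_base)
  have subP: "subspace P" and subQ: "subspace Q" unfolding P_def Q_def by auto
  \<comment> \<open>An element of \<open>Q\<close> is a multiple of \<open>y\<close> modulo
    \<open>V i\<close>; if it also lies in \<open>P\<close>, the multiple is zero because
    \<open>y\<close> is outside \<open>P\<close>.\<close>
  have PQ: "P \<inter> Q \<subseteq> V i"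
  proof
    fix z assume z: "z \<in> P \<inter> Q"
    then obtain k where k: "z - scale k y \<in> V i"
      unfolding Q_def by (auto simp: span_breakdown_eq spV)
    have "z - (z - scale k y) \<in> P"
      by (rule subspace_diff[OF subP]) (use z k VP in blast)+
    then have "scale k y \<in> P" by simp
    then have "scale (inverse k) (scale k y) \<in> P" using subP by (rule subspace_scale[rotated])
    with y(2) have "k = 0" by (cases "k = 0") auto
    then show "z \<in> V i" using k by simp
  qed
  have good: "local.rado_family U I (V(i := R))"
    if R: "subspace R" "R \<subseteq> U"
      and ok: "\<And>J. J \<subseteq> I - {i} \<Longrightarrow> dim (R \<inter> F J) + Suc (card J) \<le> dim U" for R
  proof -
    have "dim (U \<inter> (\<Inter>j\<in>J. (V(i := R)) j)) + card J \<le> dim U" if J: "J \<subseteq> I" for J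
    proof (cases "i \<in> J")
      case False
      then have "(\<Inter>j\<in>J. (V(i := R)) j) = (\<Inter>j\<in>J. V j)" by auto
      then show ?thesis using rado[OF J] by (simp add: F_def)
    next
      case True
      then have "(\<Inter>j\<in>J. (V(i := R)) j) = R \<inter> (\<Inter>j\<in>J - {i}. V j)"
        by (auto split: if_splits)
      then have "U \<inter> (\<Inter>j\<in>J. (V(i := R)) j) = R \<inter> F (J - {i})" by (auto simp: F_def)
      moreover have "Suc (card (J - {i})) = card J"
        using True J I by (meson card_Suc_Diff1 finite_subset)
      ultimately show ?thesis using ok[of "J - {i}"] J by auto
    qed
    then show ?thesis using R sub by (auto simp: rado_family_def)
  qed
  show thesis
  proof (rule ccontr)
    assume no: "\<not> thesis"
    have "\<not> local.rado_family U I (V(i := P))" "\<not> local.rado_family U I (V(i := Q))"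
      using no that VP VQ x(2) xP y(2) yQ by blast+
    with good[OF subP PU] good[OF subQ QU] obtain J J' where
      J: "J \<subseteq> I - {i}" "dim U < dim (P \<inter> F J) + Suc (card J)" and
      J': "J' \<subseteq> I - {i}" "dim U < dim (Q \<inter> F J') + Suc (card J')"
      by (meson not_le)
    have fin: "finite J" "finite J'" using J J' I by (meson finite_Diff finite_subset)+
    \<comment> \<open>The failures make the left side at least
      \<open>2 * dim U - card J - card J'\<close>. The sum on the right lies in
      \<open>F (J \<inter> J')\<close> and, by \<open>PQ\<close>, the intersection lies in
      \<open>F (insert i (J \<union> J'))\<close>; the extra index \<open>i\<close> makes their
      bounds too small by one.\<close>
    have "dim (P \<inter> F J) + dim (Q \<inter> F J')
        \<le> dim (span ((P \<inter> F J) \<union> (Q \<inter> F J'))) + dim ((P \<inter> F J) \<inter> (Q \<inter> F J'))"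
      using PU QU X J(1) J'(1)
      by (intro dim_add_le[OF X(1)] subspace_inter subP subQ subF) auto
    moreover have "dim (span ((P \<inter> F J) \<union> (Q \<inter> F J'))) \<le> dim (F (J \<inter> J'))"
    proof (rule dim_mono_finite[OF X(1)])
      show "F (J \<inter> J') \<subseteq> span X" using X by (auto simp: F_def)
      show "span ((P \<inter> F J) \<union> (Q \<inter> F J')) \<subseteq> F (J \<inter> J')"
        using J by (intro span_minimal subF) (auto simp: F_def)
    qed
    moreover have "dim ((P \<inter> F J) \<inter> (Q \<inter> F J')) \<le> dim (F (insert i (J \<union> J')))"
    proof (rule dim_mono_finite[OF X(1)])
      show "F (insert i (J \<union> J')) \<subseteq> span X" using X by (auto simp: F_def)
      show "(P \<inter> F J) \<inter> (Q \<inter> F J') \<subseteq> F (insert i (J \<union> J'))"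
        using PQ by (auto simp: F_def)
    qed
    moreover have "dim (F (J \<inter> J')) + card (J \<inter> J') \<le> dim U" using J by (intro rado) auto
    moreover have "dim (F (insert i (J \<union> J'))) + card (insert i (J \<union> J')) \<le> dim U"
      using J J' i by (intro rado) auto
    moreover have "card (insert i (J \<union> J')) = Suc (card (J \<union> J'))"
      using J J' fin by (intro card_insert_disjoint) auto
    moreover have "card J + card J' = card (J \<union> J') + card (J \<inter> J')"
      using fin by (rule card_Un_Int)
    ultimately show False using J(2) J'(2) by linarith
  qed
qed

text \<open>Enlarging one member at a time lowers the total codimension, so the process stops, and
  it can only stop at hyperplanes.\<close>

lemma rado_family_extend_to_hyperplanes:
  assumes I: "finite I" and X: "finite X" "U \<subseteq> span X" and U: "subspace U"
    and V: "local.rado_family U I V"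
  shows "\<exists>H. local.rado_family U I H \<and> (\<forall>i\<in>I. V i \<subseteq> H i \<and> Suc (dim (H i)) = dim U)"
  using V
proof (induction "\<Sum>i\<in>I. dim U - dim (V i)" arbitrary: V rule: less_induct)
  case less
  show ?case
  proof (cases "\<forall>i\<in>I. Suc (dim (V i)) = dim U")
    case True
    then show ?thesis using less.prems by blast
  next
    case False
    then obtain i where i: "i \<in> I" "Suc (dim (V i)) \<noteq> dim U" by blast
    from rado_family_enlarge[OF I X U less.prems i] obtain R where
      R: "V i \<subset> R" "local.rado_family U I (V(i := R))" .
    have RU: "R \<subseteq> U" "subspace (V i)"
      using R(2) less.prems i(1) by (force simp: rado_family_def)+
    then have RX: "R \<subseteq> span X" using X(2) by blast
    have "dim (V i) < dim R"
      using subspace_eq_of_dim_le[OF X(1) RX RU(2)] R(1) by force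
    \<comment> \<open>This keeps the truncated subtraction strict at \<open>i\<close>.\<close>
    moreover have "dim R \<le> dim U" by (rule dim_mono_finite[OF X RU(1)])
    ultimately have "(\<Sum>j\<in>I. dim U - dim ((V(i := R)) j)) < (\<Sum>j\<in>I. dim U - dim (V j))"
      using I i(1) by (intro sum_strict_mono_ex1) (auto intro!: bexI[of _ i])
    from less.hyps[OF this R(2)] obtain H where
      "local.rado_family U I H" "\<forall>j\<in>I. (V(i := R)) j \<subseteq> H j \<and> Suc (dim (H j)) = dim U" by blast
    then show ?thesis using R(1) by (intro exI[of _ H]) (auto split: if_splits)
  qed
qed

text \<open>By Grassmann, each further hyperplane lowers the dimension by at most one.\<close>

lemma dim_INT_hyperplanes_ge:
  assumes X: "finite X" "U \<subseteq> span X" and U: "subspace U"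
    and J: "finite J" "\<And>j. j \<in> J \<Longrightarrow> subspace (H j)" "\<And>j. j \<in> J \<Longrightarrow> H j \<subseteq> U"
      "\<And>j. j \<in> J \<Longrightarrow> Suc (dim (H j)) = dim U"
  shows "dim U \<le> dim (U \<inter> (\<Inter>j\<in>J. H j)) + card J"
  using J
proof (induction J rule: finite_induct)
  case empty
  then show ?case by simp
next
  case (insert k J)
  let ?W = "U \<inter> (\<Inter>j\<in>J. H j)"
  have W: "subspace ?W" using U insert.prems(1) by (intro subspace_INT) auto
  have HU: "H k \<subseteq> U" using insert.prems(2) by blast
  have "dim (H k) + dim ?W \<le> dim (span (H k \<union> ?W)) + dim (H k \<inter> ?W)"
    using X HU W insert.prems(1) by (intro dim_add_le[OF X(1)]) auto
  moreover have "dim (span (H k \<union> ?W)) \<le> dim U"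
    using HU U by (intro dim_mono_finite[OF X] span_minimal) auto
  moreover have "H k \<inter> ?W = U \<inter> (\<Inter>j\<in>insert k J. H j)" by auto
  moreover have "dim U \<le> dim ?W + card J" using insert.IH insert.prems by blast
  moreover have "Suc (dim (H k)) = dim U" using insert.prems(3) by blast
  ultimately show ?case using insert.hyps by simp
qed

text \<open>The hyperplanes all together meet in zero, but leaving out \<open>H i\<close> leaves a
  nonzero vector \<open>b i\<close>. So \<open>b i\<close> avoids \<open>H i\<close> and lies in all
  the others, which makes \<open>b\<close> a basis dual to the hyperplanes.\<close>

lemma rado_family_basis:
  assumes I: "finite I" and X: "finite X" "U \<subseteq> span X" and U: "subspace U"
    and V: "local.rado_family U I V" and card: "card I = dim U"
  obtains b where "inj_on b I" "independent (b ` I)" "span (b ` I) = U"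
    "\<And>i. i \<in> I \<Longrightarrow> V i \<subseteq> span (b ` (I - {i}))"
proof -
  from rado_family_extend_to_hyperplanes[OF I X U V] obtain H where
    H: "local.rado_family U I H" "\<And>i. i \<in> I \<Longrightarrow> V i \<subseteq> H i" "\<And>i. i \<in> I \<Longrightarrow> Suc (dim (H i)) = dim U"
    by blast
  have sub: "subspace (H j)" "H j \<subseteq> U" if "j \<in> I" for j
    using H(1) that by (auto simp: rado_family_def)
  have "dim (U \<inter> (\<Inter>j\<in>I. H j)) = 0"
    using H(1) card by (auto simp: rado_family_def)
  moreover have "subspace (U \<inter> (\<Inter>j\<in>I. H j))" using U sub by (intro subspace_INT) auto
  ultimately have zero: "U \<inter> (\<Inter>j\<in>I. H j) = {0}"
    using subspace_eq_of_dim_le[of X "U \<inter> (\<Inter>j\<in>I. H j)" "{0}"] X subspace_0 by auto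
  have "\<exists>v. v \<noteq> 0 \<and> v \<in> U \<inter> (\<Inter>j\<in>I - {i}. H j)" if i: "i \<in> I" for i
  proof (rule ccontr)
    assume "\<not> ?thesis"
    then have "U \<inter> (\<Inter>j\<in>I - {i}. H j) \<subseteq> span {}" by auto
    then have "dim (U \<inter> (\<Inter>j\<in>I - {i}. H j)) \<le> card ({} :: 'b set)" by (rule dim_le_card) simp
    moreover have "dim U \<le> dim (U \<inter> (\<Inter>j\<in>I - {i}. H j)) + card (I - {i})"
      using I sub H(3) by (intro dim_INT_hyperplanes_ge[OF X U]) auto
    moreover have "Suc (card (I - {i})) = card I" using I i by (rule card_Suc_Diff1)
    ultimately show False using card by simp
  qed
  then obtain b where b: "\<And>i. i \<in> I \<Longrightarrow> b i \<noteq> 0 \<and> b i \<in> U \<inter> (\<Inter>j\<in>I - {i}. H j)" by metis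
  have bH: "b j \<in> H i" if "i \<in> I" "j \<in> I - {i}" for i j using b that by blast
  have bnH: "b i \<notin> H i" if i: "i \<in> I" for i
  proof
    assume "b i \<in> H i"
    with b[OF i] have "b i \<in> U \<inter> (\<Inter>j\<in>I. H j)" by blast
    with zero b[OF i] show False by simp
  qed
  have spH: "span (b ` (I - {i})) \<subseteq> H i" if "i \<in> I" for i
    using that bH sub by (intro span_minimal) auto
  have inj: "inj_on b I"
  proof (rule inj_onI, rule ccontr)
    fix i j assume "i \<in> I" "j \<in> I" "b i = b j" "i \<noteq> j"
    then show False using bH[of i j] bnH[of i] by auto
  qed
  have ind: "independent (b ` I)"
  proof
    assume "dependent (b ` I)"
    then obtain i where i: "i \<in> I" "b i \<in> span (b ` I - {b i})" by (auto simp: dependent_def)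
    have "b ` I - {b i} \<subseteq> b ` (I - {i})" by auto
    with i spH[OF i(1)] bnH[OF i(1)] show False using span_mono by blast
  qed
  have "span (b ` I) = U"
  proof (rule subspace_eq_of_dim_le[OF X])
    show "span (b ` I) \<subseteq> U" using b U by (intro span_minimal) auto
    show "dim U \<le> dim (span (b ` I))"
      using ind inj card by (simp add: dim_eq_card_independent card_image)
  qed simp
  moreover have "V i \<subseteq> span (b ` (I - {i}))" if i: "i \<in> I" for i
  proof -
    \<comment> \<open>The span is contained in \<open>H i\<close>, and both have dimension
      \<open>card I - 1\<close>.\<close>
    have "span (b ` (I - {i})) = H i"
    proof (rule subspace_eq_of_dim_le[OF X(1)])
      show "H i \<subseteq> span X" using sub[OF i] X by blast
      have "independent (b ` (I - {i}))" using ind by (rule independent_mono) auto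
      then have "dim (span (b ` (I - {i}))) = card (b ` (I - {i}))"
        by (rule dim_span_eq_card_independent)
      also have "\<dots> = card (I - {i})" using inj by (intro card_image) (auto intro: inj_on_subset)
      also have "Suc \<dots> = card I" using I i by (rule card_Suc_Diff1)
      finally show "dim (H i) \<le> dim (span (b ` (I - {i})))"
        using card_Suc_Diff1[OF I i] H(3)[OF i] card by simp
    qed (use spH[OF i] in auto)
    then show ?thesis using H(2)[OF i] by simp
  qed
  ultimately show thesis using that inj ind by blast
qed

end

section \<open>Multiplication maps and Kemperman's transform\<close>

context central_extension
begin

lemma module_hom_mult_right: "module_hom (\<lambda>c x. emb c * x) (\<lambda>c x. emb c * x) (\<lambda>x. x * e)"
  by unfold_locales (simp_all add: algebra_simps)

lemma module_hom_mult_left: "module_hom (\<lambda>c x. emb c * x) (\<lambda>c x. emb c * x) (\<lambda>x. e * x)"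
  by unfold_locales (simp_all add: algebra_simps, metis emb_central mult.assoc)

lemma subspace_mult_left_vimage: "vs.subspace B \<Longrightarrow> vs.subspace {x. e * x \<in> B}"
  using module_hom.subspace_vimage[OF module_hom_mult_left] by (simp add: vimage_def)

lemma subspace_mult_right_vimage: "vs.subspace B \<Longrightarrow> vs.subspace {x. x * e \<in> B}"
  using module_hom.subspace_vimage[OF module_hom_mult_right] by (simp add: vimage_def)

text \<open>Otherwise right multiplication by \<open>e\<close> would map \<open>A\<close> onto
  itself by dimension; then \<open>e = x * e\<close> for some \<open>x\<close> in \<open>A\<close>,
  which forces \<open>x = 1\<close>.\<close>

lemma ex_mult_right_notin:
  assumes X: "finite X" "A \<subseteq> vs.span X" and A: "vs.subspace A" "1 \<notin> A" and e: "e \<in> A" "e \<noteq> 0"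
  shows "\<exists>a\<in>A. a * e \<notin> A"
proof (rule ccontr)
  assume "\<not> ?thesis"
  then have sub: "(\<lambda>x. x * e) ` A \<subseteq> A" by blast
  have "vs.dim ((\<lambda>x. x * e) ` A) = vs.dim A"
    using e(2)
    by (intro vs.dim_image_inverse[OF module_hom_mult_right module_hom_mult_right[of "inverse e"] _ X])
      (simp add: mult.assoc)
  then have "(\<lambda>x. x * e) ` A = A"
    using A(1) sub
    by (intro vs.subspace_eq_of_dim_le[OF X] module_hom.subspace_image[OF module_hom_mult_right]) auto
  then obtain x where "x \<in> A" "e = x * e" using e(1) by blast
  then show False using A(2) e(2) by simp
qed

text \<open>
  Kemperman's transform: for nonzero \<open>e\<close> in both \<open>A\<close> and \<open>W\<close>, the pairs
  \<open>(A + A e, W \<inter> e\<^sup>-\<^sup>1 W)\<close> and \<open>(A \<inter> A e\<^sup>-\<^sup>1, W + e W)\<close> satisfy the same hypotheses, and the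
  two dimension sums add up to at least twice the original one. Since \<open>1 \<notin> A\<close>, the first
  transform strictly enlarges \<open>A\<close>.
\<close>

lemma dim_add_le_of_mult_subset:
  assumes X: "finite X" "B \<subseteq> vs.span X" and B: "vs.subspace B" "1 \<notin> B"
    and A: "vs.subspace A" "A \<subseteq> B" and W: "vs.subspace W" "W \<subseteq> B"
    and AW: "\<And>a w. a \<in> A \<Longrightarrow> w \<in> W \<Longrightarrow> a * w \<in> B"
  shows "vs.dim A + vs.dim W \<le> vs.dim B"
  using A W AW
\<comment> \<open>The order is lexicographic: first the sum of the dimensions grows, then, for equal
  sums, the dimension of \<open>A\<close>. Both are bounded through \<open>dim B\<close>.\<close>
proof (induction "(A, W)" arbitrary: A W
    rule: wf_induct[OF wf_measures[of "[\<lambda>(A, W). 2 * vs.dim B - (vs.dim A + vs.dim W),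
      \<lambda>(A, W). vs.dim B - vs.dim A]"], consumes 0, case_names less])
  case (less A W)
  note A = less.prems(1,2) and W = less.prems(3,4) and AW = less.prems(5)
  have AX: "A \<subseteq> vs.span X" and WX: "W \<subseteq> vs.span X" using A W X by auto
  have le: "vs.dim S \<le> vs.dim B" if "S \<subseteq> B" for S by (rule vs.dim_mono_finite[OF X that])
  show ?case
  proof (rule ccontr)
    assume gt: "\<not> ?case"
    \<comment> \<open>For zero intersection the sum is direct inside \<open>B\<close>, and the bound
      holds already.\<close>
    have "A \<inter> W \<noteq> {0}"
    proof
      assume "A \<inter> W = {0}"
      then have "vs.dim A + vs.dim W \<le> vs.dim (vs.span (A \<union> W))"
        using vs.dim_add_le[OF X(1) AX WX A(1) W(1)] vs.dim_le_card[of "{0}" "{}"] by simp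
      also have "\<dots> \<le> vs.dim B" using A W B by (intro le vs.span_minimal) auto
      finally show False using gt by simp
    qed
    then obtain e where e: "e \<in> A" "e \<in> W" "e \<noteq> 0"
      using A(1) W(1) vs.subspace_0 by blast
    define A1 where "A1 = vs.span (A \<union> (\<lambda>x. x * e) ` A)"
    define W1 where "W1 = {w \<in> W. e * w \<in> W}"
    define A2 where "A2 = {a \<in> A. a * e \<in> A}"
    define W2 where "W2 = vs.span (W \<union> (\<lambda>x. e * x) ` W)"
    have sub: "vs.subspace A1" "vs.subspace W2" unfolding A1_def W2_def by auto
    have "vs.subspace (W \<inter> {w. e * w \<in> W})" "vs.subspace (A \<inter> {a. a * e \<in> A})"
      using A W by (auto intro: vs.subspace_inter subspace_mult_left_vimage subspace_mult_right_vimage)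
    then have sub': "vs.subspace W1" "vs.subspace A2"
      unfolding W1_def A2_def by (simp_all add: Int_def)
    \<comment> \<open>Right multiples of \<open>A\<close> by \<open>e\<close> stay in
      \<open>B\<close> because \<open>e\<close> is in \<open>W\<close>; left multiples of
      \<open>W\<close> stay there because \<open>e\<close> is in \<open>A\<close>.\<close>
    have A1B: "A1 \<subseteq> B" unfolding A1_def using A B AW e by (intro vs.span_minimal) auto
    have W2B: "W2 \<subseteq> B" unfolding W2_def using W B AW e by (intro vs.span_minimal) auto
    have sumA: "2 * vs.dim A \<le> vs.dim A1 + vs.dim A2"
      unfolding A1_def A2_def using e(3)
      by (intro vs.dim_transform[OF module_hom_mult_right module_hom_mult_right[of "inverse e"] _ X(1) AX A(1)])
        (simp add: mult.assoc)
    have sumW: "2 * vs.dim W \<le> vs.dim W2 + vs.dim W1"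
      unfolding W1_def W2_def using e(3)
      by (intro vs.dim_transform[OF module_hom_mult_left module_hom_mult_left[of "inverse e"] _ X(1) WX W(1)])
        (simp add: mult.assoc[symmetric])
    \<comment> \<open>By associativity \<open>(x * e) * w = x * (e * w)\<close>, and
      \<open>e * w\<close> is in \<open>W\<close> by the choice of \<open>W1\<close>;
      \<open>prod2\<close> is the mirror image.\<close>
    have prod1: "a * w \<in> B" if a: "a \<in> A1" and w: "w \<in> W1" for a w
    proof -
      have "A1 \<subseteq> {a. a * w \<in> B}" unfolding A1_def
      proof (rule vs.span_minimal)
        show "A \<union> (\<lambda>x. x * e) ` A \<subseteq> {a. a * w \<in> B}"
          using w AW by (auto simp: W1_def mult.assoc)
      qed (rule subspace_mult_right_vimage[OF B(1)])
      with a show ?thesis by blast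
    qed
    have prod2: "a * w \<in> B" if a: "a \<in> A2" and w: "w \<in> W2" for a w
    proof -
      have "W2 \<subseteq> {w. a * w \<in> B}" unfolding W2_def
      proof (rule vs.span_minimal)
        show "W \<union> (\<lambda>x. e * x) ` W \<subseteq> {w. a * w \<in> B}"
          using a AW by (auto simp: A2_def mult.assoc[symmetric])
      qed (rule subspace_mult_left_vimage[OF B(1)])
      with w show ?thesis by blast
    qed
    obtain a where a: "a \<in> A" "a * e \<notin> A"
      using ex_mult_right_notin[OF X(1) AX A(1) _ e(1,3)] A(2) B(2) by blast
    have AA1: "A \<subseteq> A1" "a * e \<in> A1" unfolding A1_def using a by (auto intro: vs.span_base)
    have "vs.dim A < vs.dim A1"
      using vs.subspace_eq_of_dim_le[of X A1 A] X A1B A(1) AA1 a(2) by fastforce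
    have W1B: "W1 \<subseteq> B" and A2B: "A2 \<subseteq> B" using A W by (auto simp: W1_def A2_def)
    note bounds = le[OF A1B] le[OF W1B] le[OF A2B] le[OF W2B] le[OF A(2)] le[OF W(2)]
    show False
    \<comment> \<open>If the first transform loses total dimension, the second gains by
      \<open>sumA\<close> and \<open>sumW\<close>. Either way the new pair precedes the old one and
      violates the bound as well.\<close>
    proof (cases "vs.dim A + vs.dim W \<le> vs.dim A1 + vs.dim W1")
      case True
      have "((A1, W1), (A, W)) \<in> measures [\<lambda>(A, W). 2 * vs.dim B - (vs.dim A + vs.dim W),
          \<lambda>(A, W). vs.dim B - vs.dim A]"
        using True \<open>vs.dim A < vs.dim A1\<close> bounds by auto
      from less.hyps[rule_format, OF this refl sub(1) A1B sub'(1) W1B prod1]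
      show False using True gt by simp
    next
      case False
      then have lt: "vs.dim A + vs.dim W < vs.dim A2 + vs.dim W2" using sumA sumW by linarith
      then have "((A2, W2), (A, W)) \<in> measures [\<lambda>(A, W). 2 * vs.dim B - (vs.dim A + vs.dim W),
          \<lambda>(A, W). vs.dim B - vs.dim A]"
        using bounds by auto
      from less.hyps[rule_format, OF this refl sub'(2) A2B sub(2) W2B prod2]
      show False using lt gt by simp
    qed
  qed
qed

section \<open>Matching a subspace to itself\<close>

text \<open>The span of the \<open>a i\<close> with \<open>i\<close> in \<open>J\<close> has
  dimension \<open>card J\<close> and multiplies the intersection \<open>W\<close> into
  \<open>B\<close>, so the product bound is exactly Rado's condition.\<close>

lemma rado_family_mult:
  assumes X: "finite X" "B \<subseteq> vs.span X" and B: "vs.subspace B" "1 \<notin> B"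
    and a: "inj_on a I" "vs.independent (a ` I)" "a ` I \<subseteq> B"
  shows "vs.rado_family B I (\<lambda>i. {x \<in> B. a i * x \<in> B})"
  unfolding vs.rado_family_def
proof (intro conjI ballI allI impI)
  fix i
  show sub: "vs.subspace {x \<in> B. a i * x \<in> B}"
    using vs.subspace_inter[OF B(1) subspace_mult_left_vimage[OF B(1)], of "a i"] by (simp add: Int_def)
  show "{x \<in> B. a i * x \<in> B} \<subseteq> B" by blast
next
  fix J assume J: "J \<subseteq> I"
  define W where "W = B \<inter> (\<Inter>i\<in>J. {x \<in> B. a i * x \<in> B})"
  have W: "vs.subspace W"
    unfolding W_def using vs.subspace_inter[OF B(1) subspace_mult_left_vimage[OF B(1)]]
    by (intro vs.subspace_INT[OF B(1)]) (simp add: Int_def)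
  have "vs.dim (vs.span (a ` J)) + vs.dim W \<le> vs.dim B"
  proof (rule dim_add_le_of_mult_subset[OF X B _ _ W])
    show "vs.span (a ` J) \<subseteq> B" using a J B by (intro vs.span_minimal) auto
    fix x w assume x: "x \<in> vs.span (a ` J)" and w: "w \<in> W"
    have "vs.span (a ` J) \<subseteq> {x. x * w \<in> B}"
      using w by (intro vs.span_minimal subspace_mult_right_vimage[OF B(1)]) (auto simp: W_def)
    with x show "x * w \<in> B" by blast
  qed (auto simp: W_def)
  moreover have "vs.independent (a ` J)" by (rule vs.independent_mono[OF a(2) image_mono[OF J]])
  then have "vs.dim (vs.span (a ` J)) = card (a ` J)" by (rule vs.dim_span_eq_card_independent)
  moreover have "card (a ` J) = card J" using a(1) J by (meson card_image inj_on_subset)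
  ultimately show "vs.dim (B \<inter> (\<Inter>i\<in>J. {x \<in> B. a i * x \<in> B})) + card J \<le> vs.dim B"
    by (simp add: W_def)
qed

lemma subspace_matched_self:
  assumes B: "fin_dim_subspace B" "1 \<notin> B"
  shows "subspace_matched B B"
  unfolding subspace_matched_def
proof (intro allI impI)
  fix a assume a: "indexed_basis (vs.dim B) a B"
  from B(1) obtain X where X: "finite X" "B \<subseteq> vs.span X" and sub: "vs.subspace B"
    unfolding fin_dim_subspace_def by blast
  have "vs.rado_family B {1..vs.dim B} (\<lambda>i. {x \<in> B. a i * x \<in> B})"
    using a by (intro rado_family_mult[OF X sub B(2)]) (auto simp: indexed_basis_def intro: vs.span_base)
  from vs.rado_family_basis[OF _ X sub this] obtain b where
    "inj_on b {1..vs.dim B}" "vs.independent (b ` {1..vs.dim B})" "vs.span (b ` {1..vs.dim B}) = B"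
    "\<And>i. i \<in> {1..vs.dim B} \<Longrightarrow> {x \<in> B. a i * x \<in> B} \<subseteq> vs.span (b ` ({1..vs.dim B} - {i}))"
    by auto
  then show "\<exists>b. indexed_basis (vs.dim B) b B \<and> basis_matched (vs.dim B) B a B b"
    unfolding indexed_basis_def basis_matched_def by blast
qed

text \<open>If \<open>a i = 1\<close>, then \<open>a i * b i = b i\<close> lies in \<open>B\<close>,
  so a matching would put \<open>b i\<close> into the span of the other basis vectors.\<close>

lemma not_subspace_matched_self:
  assumes B: "fin_dim_subspace B" "1 \<in> B"
  shows "\<not> subspace_matched B B"
proof
  assume m: "subspace_matched B B"
  from B(1) obtain X where X: "finite X" "B \<subseteq> vs.span X" and sub: "vs.subspace B"
    unfolding fin_dim_subspace_def by blast
  have "{1} \<subseteq> B" "vs.independent {1}" using B(2) by auto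
  from vs.maximal_independent_subset_extend[OF this] obtain C where
    C: "{1} \<subseteq> C" "C \<subseteq> B" "vs.independent C" "B \<subseteq> vs.span C" by blast
  have fin: "finite C" using vs.independent_span_bound[OF X(1) C(3)] C(2) X(2) by blast
  have "card C = vs.dim B" by (rule vs.basis_card_eq_dim[OF C(2,4,3)])
  then obtain a where a: "bij_betw a {1..vs.dim B} C"
    using ex_bij_betw_nat_finite_1[OF fin] by auto
  have "indexed_basis (vs.dim B) a B"
    unfolding indexed_basis_def
    using a C sub vs.span_minimal[of C B] by (auto simp: bij_betw_def)
  then obtain b where b: "indexed_basis (vs.dim B) b B" "basis_matched (vs.dim B) B a B b"
    using m unfolding subspace_matched_def by blast
  obtain i where i: "i \<in> {1..vs.dim B}" "a i = 1" using a C(1) by (auto simp: bij_betw_def)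
  have "b i \<in> vs.span (b ` {1..vs.dim B})" using i(1) by (intro vs.span_base) blast
  then have "b i \<in> B" using b(1) by (simp add: indexed_basis_def)
  then have "b i \<in> vs.span (b ` ({1..vs.dim B} - {i}))"
    using b(2) i unfolding basis_matched_def by auto
  \<comment> \<open>Injectivity turns the removal of an index into the removal of a vector.\<close>
  moreover have "b ` ({1..vs.dim B} - {i}) = b ` {1..vs.dim B} - {b i}"
    using b(1) i(1) inj_on_image_set_diff[of b "{1..vs.dim B}" "{1..vs.dim B}" "{i}"]
    unfolding indexed_basis_def by blast
  ultimately have "vs.dependent (b ` {1..vs.dim B})"
    unfolding vs.dependent_def using imageI[OF i(1), of b] by metis
  then show False using b(1) by (simp add: indexed_basis_def)
qed

end

theorem theorem2p8:
  fixes emb :: "'k::field \<Rightarrow> 'l::division_ring" and B :: "'l set"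
  assumes "central_extension emb"
    and "central_extension.fin_dim_subspace emb B"
  shows "central_extension.subspace_matched emb B B \<longleftrightarrow> 1 \<notin> B"
  using central_extension.subspace_matched_self[OF assms]
    central_extension.not_subspace_matched_self[OF assms] by blast

end
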